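(* For a regular Hausdorff space $X$ the following are equivalent: (1) $X$ is metrizable; (2) $\mathcal{K}(X)$ has a $\sigma$-locally finite weak base; (3) $\mathcal{K}(X)$ is metrizable.
   Context: $\mathcal{K}(X)$ is the set of nonempty compact subsets of $X$ with the Vietoris topology (base: $\langle U_1,\dots,U_k\rangle=\{K: K\subset\bigcup_i U_i,\ K\cap U_j\neq\emptyset\ \forall j\}$, $U_i$ open in $X$). A weak base for $Y$ is a cover $\mathcal{P}=\bigcup_{y\in Y}\mathcal{P}_y$ such that: for $U,V\in\mathcal{P}_y$ there is $W\in\mathcal{P}_y$ with $W\subset U\cap V$; each member of $\mathcal{P}_y$ contains $y$, and for each open $U\ni y$ some $P\in\mathcal{P}_y$ has $P\subset U$; and $G\subset Y$ is open whenever for each $y\in G$ some $P\in\mathcal{P}_y$ has $P\subset G$. $\sigma$-locally finite means a countable union of locally finite families. *)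

theory Defs
  imports "HOL-Analysis.Analysis"
begin

definition compacts_of :: "'a topology \<Rightarrow> 'a set set" where
  "compacts_of X = {K. K \<noteq> {} \<and> compactin X K}"

definition vietoris_basic :: "'a topology \<Rightarrow> 'a set list \<Rightarrow> 'a set set" where
  "vietoris_basic X Us =
     {K \<in> compacts_of X. K \<subseteq> \<Union>(set Us) \<and> (\<forall>U\<in>set Us. K \<inter> U \<noteq> {})}"

definition vietoris :: "'a topology \<Rightarrow> 'a set topology" where
  "vietoris X = topology_generated_by
     {vietoris_basic X Us | Us. Us \<noteq> [] \<and> (\<forall>U\<in>set Us. openin X U)}"

definition weak_base :: "'b topology \<Rightarrow> ('b \<Rightarrow> 'b set set) \<Rightarrow> bool" where
  "weak_base Y P \<longleftrightarrow>
     (\<forall>y\<in>topspace Y.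
        (\<forall>A\<in>P y. y \<in> A \<and> A \<subseteq> topspace Y)
      \<and> (\<forall>U\<in>P y. \<forall>V\<in>P y. \<exists>W\<in>P y. W \<subseteq> U \<inter> V)
      \<and> (\<forall>U. openin Y U \<and> y \<in> U \<longrightarrow> (\<exists>A\<in>P y. A \<subseteq> U)))
   \<and> (\<forall>G. G \<subseteq> topspace Y \<and> (\<forall>y\<in>G. \<exists>A\<in>P y. A \<subseteq> G) \<longrightarrow> openin Y G)"

definition locally_finite_family :: "'b topology \<Rightarrow> 'b set set \<Rightarrow> bool" where
  "locally_finite_family Y \<F> \<longleftrightarrow>
     (\<forall>y\<in>topspace Y. \<exists>V. openin Y V \<and> y \<in> V \<and> finite {A\<in>\<F>. A \<inter> V \<noteq> {}})"

definition sigma_locally_finite :: "'b topology \<Rightarrow> 'b set set \<Rightarrow> bool" where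
  "sigma_locally_finite Y \<P> \<longleftrightarrow>
     (\<exists>\<F> :: nat \<Rightarrow> 'b set set. \<P> = (\<Union>n. \<F> n) \<and> (\<forall>n. locally_finite_family Y (\<F> n)))"

end

theory Submission
  imports Defs
begin

text \<open>
  The hyperspace of a metrizable space is metrized by the Hausdorff distance, the singletons embed
  \<open>X\<close> into it, and the discrete families in Stone's argument give every metrizable
  space a \<open>\<sigma>\<close>-locally finite base. The remaining implication, from a
  \<open>\<sigma>\<close>-locally finite weak base of the hyperspace to metrizability of
  \<open>X\<close>, rests on a diagonal argument. If \<open>x\<^sub>n \<rightarrow> z\<close> and
  \<open>x\<^sub>n\<^sub>m \<rightarrow> x\<^sub>n\<close>, put \<open>C = {z, x\<^sub>0, x\<^sub>1, \<dots>}\<close>.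
  The map \<open>u \<mapsto> C \<union> {u}\<close> collapses \<open>C\<close> to one point, so the points
  \<open>C \<union> {x\<^sub>n\<^sub>m}\<close> form a sequential fan at \<open>C\<close>; a countable weak base at
  \<open>C\<close> picks \<open>m(n)\<close> with \<open>C \<union> {x\<^sub>n\<^sub>m} \<rightarrow> C\<close> for \<open>m = m(n)\<close>, and if
  \<open>m(n)\<close> is also large enough to keep the chosen points away from every single
  \<open>x\<^sub>i\<close>, then they converge to \<open>z\<close>. Hence limits of sequences form a closed set,
  the weak base that \<open>X\<close> inherits consists of neighbourhoods, its interiors form a
  \<open>\<sigma>\<close>-locally finite base, and the Nagata--Smirnov theorem applies.
\<close>


subsection \<open>The Nagata--Smirnov metrization theorem\<close>

text \<open>The metric is the supremum over \<open>I\<close> of the distances between the values of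
  \<open>g i\<close>. Equicontinuity gives each metric ball a neighbourhood of its centre, so
  metrically open sets are open in \<open>X\<close>; the separation hypothesis gives the converse
  and, with T1, makes distinct points have positive distance.\<close>

lemma metrizable_space_equicontinuous_family:
  fixes g :: "'i \<Rightarrow> 'a \<Rightarrow> real"
  assumes t1: "t1_space X"
    and bound: "\<And>i x. g i x \<in> {0..1}"
    and equi: "\<And>x e. \<lbrakk>x \<in> topspace X; 0 < e\<rbrakk> \<Longrightarrow>
        \<exists>V. openin X V \<and> x \<in> V \<and> (\<forall>y\<in>V. \<forall>i\<in>I. \<bar>g i x - g i y\<bar> \<le> e)"
    and sep: "\<And>x U. \<lbrakk>openin X U; x \<in> U\<rbrakk> \<Longrightarrow>
        \<exists>i\<in>I. \<exists>e>0. \<forall>y\<in>topspace X. \<bar>g i x - g i y\<bar> < e \<longrightarrow> y \<in> U"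
  shows "metrizable_space X"
proof -
  \<comment> \<open>Inserting 0 keeps the supremum meaningful when \<open>I\<close> is empty and
    leaves it unchanged otherwise, all differences being nonnegative.\<close>
  define d where "d x y = Sup (insert 0 ((\<lambda>i. \<bar>g i x - g i y\<bar>) ` I))" for x y
  have diff_le: "\<bar>g i x - g i y\<bar> \<le> 1" for i x y
    using bound[of i x] bound[of i y] by auto
  have bdd: "bdd_above (insert 0 ((\<lambda>i. \<bar>g i x - g i y\<bar>) ` I))" for x y
    using diff_le by (auto intro!: bdd_aboveI2)
  have upper: "\<bar>g i x - g i y\<bar> \<le> d x y" if "i \<in> I" for i x y
    unfolding d_def using that by (intro cSup_upper bdd) auto
  have least: "d x y \<le> c" if "0 \<le> c" "\<And>i. i \<in> I \<Longrightarrow> \<bar>g i x - g i y\<bar> \<le> c" for x y c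
    unfolding d_def using that by (intro cSup_least) auto
  have nonneg: "0 \<le> d x y" for x y
    unfolding d_def by (intro cSup_upper bdd) auto
  have zero: "d x y = 0 \<longleftrightarrow> x = y" if x: "x \<in> topspace X" and y: "y \<in> topspace X" for x y
  proof
    assume 0: "d x y = 0"
    show "x = y"
    proof (rule ccontr)
      assume "x \<noteq> y"
      with t1 x y obtain U where U: "openin X U" "x \<in> U" "y \<notin> U"
        unfolding t1_space_def by blast
      with sep obtain i e where "i \<in> I" "e > 0" "\<bar>g i x - g i y\<bar> < e \<longrightarrow> y \<in> U"
        using y by meson
      with upper[of i x y] 0 U show False by auto
    qed
  next
    assume "x = y"
    then show "d x y = 0"
      using least[of 0 x y] nonneg[of x y] by auto
  qed
  interpret Metric_space "topspace X" d
  proof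
    show "d x y = d y x" for x y
      unfolding d_def by (simp add: abs_minus_commute)
    show "d x z \<le> d x y + d y z" for x y z
    proof (rule least)
      fix i assume "i \<in> I"
      then show "\<bar>g i x - g i z\<bar> \<le> d x y + d y z"
        using upper[of i x y] upper[of i y z] by linarith
    qed (simp add: nonneg)
  qed (simp_all add: nonneg zero)
  have "openin mtopology U \<longleftrightarrow> openin X U" for U
  proof
    assume U: "openin mtopology U"
    show "openin X U"
    proof (subst openin_subopen, intro strip)
      fix x assume x: "x \<in> U"
      with U obtain r where r: "r > 0" "mball x r \<subseteq> U" and xX: "x \<in> topspace X"
        unfolding openin_mtopology by blast
      obtain V where V: "openin X V" "x \<in> V" "\<forall>y\<in>V. \<forall>i\<in>I. \<bar>g i x - g i y\<bar> \<le> r/2"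
        using equi[OF xX, of "r/2"] r by auto
      have "V \<subseteq> mball x r"
      proof
        fix y assume y: "y \<in> V"
        then have "d x y \<le> r/2" using V r by (intro least) auto
        then show "y \<in> mball x r"
          using y V xX r openin_subset by fastforce
      qed
      then show "\<exists>T. openin X T \<and> x \<in> T \<and> T \<subseteq> U" using V r by blast
    qed
  next
    assume U: "openin X U"
    have "\<exists>r>0. mball x r \<subseteq> U" if x: "x \<in> U" for x
    proof -
      obtain i e where "i \<in> I" "e > 0" and *: "\<forall>y\<in>topspace X. \<bar>g i x - g i y\<bar> < e \<longrightarrow> y \<in> U"
        using sep[OF U x] by auto
      then have "mball x e \<subseteq> U"
        by (auto dest: le_less_trans[OF upper])
      with \<open>e > 0\<close> show ?thesis by blast
    qed
    then show "openin mtopology U"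
      using openin_subset[OF U] by (auto simp: openin_mtopology)
  qed
  then have "X = mtopology" by (simp add: topology_eq)
  then show ?thesis using metrizable_space_mtopology by simp
qed

section \<open>Normality from a sigma-locally finite base\<close>

lemma locally_finite_family_imp_in:
  assumes "locally_finite_family X \<F>" "\<And>A. A \<in> \<F> \<Longrightarrow> A \<subseteq> topspace X"
  shows "locally_finite_in X \<F>"
  using assms unfolding locally_finite_family_def locally_finite_in_def by blast

lemma regular_space_closure_base:
  assumes reg: "regular_space X" and U: "openin X U" "x \<in> U"
    and base: "\<And>U x. \<lbrakk>openin X U; x \<in> U\<rbrakk> \<Longrightarrow> \<exists>n. \<exists>A\<in>\<F> n. x \<in> A \<and> A \<subseteq> U"
  shows "\<exists>n. \<exists>A\<in>\<F> n. x \<in> A \<and> X closure_of A \<subseteq> U"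
proof -
  have "closedin X (topspace X - U)" "x \<in> topspace X - (topspace X - U)"
    using U openin_subset by fastforce+
  with reg obtain W where W: "openin X W" "x \<in> W" "disjnt (topspace X - U) (X closure_of W)"
    unfolding regular_space by meson
  from base[OF W(1,2)] obtain n A where A: "A \<in> \<F> n" "x \<in> A" "A \<subseteq> W" by blast
  then have "X closure_of A \<subseteq> X closure_of W" by (simp add: closure_of_mono)
  also have "\<dots> \<subseteq> U"
    using W(3) closure_of_subset_topspace[of X W] by (auto simp: disjnt_iff)
  finally show ?thesis using A by blast
qed

text \<open>This follows the proof that regular Lindelof spaces are normal. A countable cover is
  obtained by merging, for each \<open>n\<close>, all members of \<open>\<F> n\<close> whose closure
  misses the other closed set; by local finiteness the closure of the merged set is the union of the
  closures, so it misses that set too.\<close>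

lemma regular_sigma_locally_finite_base_imp_normal_space:
  fixes \<F> :: "nat \<Rightarrow> 'a set set"
  assumes reg: "regular_space X"
    and lf: "\<And>n. locally_finite_family X (\<F> n)"
    and op: "\<And>n A. A \<in> \<F> n \<Longrightarrow> openin X A"
    and base: "\<And>U x. \<lbrakk>openin X U; x \<in> U\<rbrakk> \<Longrightarrow> \<exists>n. \<exists>A\<in>\<F> n. x \<in> A \<and> A \<subseteq> U"
  shows "normal_space X"
proof -
  have cover: "\<exists>h :: nat \<Rightarrow> 'a set. (\<forall>n. openin X (h n) \<and> disjnt T (X closure_of (h n))) \<and> S \<subseteq> \<Union>(range h)"
    if S: "closedin X S" and T: "closedin X T" and ST: "disjnt S T" for S T
  proof -
    let ?G = "\<lambda>n. {A \<in> \<F> n. disjnt T (X closure_of A)}"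
    let ?h = "\<lambda>n. \<Union>(?G n)"
    have "openin X (?h n)" for n using op by auto
    moreover have "locally_finite_in X (?G n)" for n
    proof (rule locally_finite_in_subset)
      show "locally_finite_in X (\<F> n)"
        using lf op openin_subset by (blast intro: locally_finite_family_imp_in)
    qed auto
    then have "disjnt T (X closure_of (?h n))" for n
      by (auto simp: closure_of_locally_finite_Union disjnt_iff)
    moreover have "S \<subseteq> (\<Union>n. ?h n)"
    proof
      fix x assume x: "x \<in> S"
      have "openin X (topspace X - T)" "x \<in> topspace X - T"
        using T x ST closedin_subset[OF S] by (auto simp: disjnt_iff)
      from regular_space_closure_base[OF reg this, of \<F>, OF base]
      obtain n A where "A \<in> \<F> n" "x \<in> A" "X closure_of A \<subseteq> topspace X - T" by blast
      then show "x \<in> (\<Union>n. ?h n)" by (auto simp: disjnt_iff)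
    qed
    ultimately show ?thesis by (intro exI[of _ ?h] conjI allI) auto
  qed
  show ?thesis
    unfolding normal_space_def
  proof clarify
    fix S T
    assume clo: "closedin X S" "closedin X T" and ST: "disjnt S T"
    obtain h :: "nat \<Rightarrow> 'a set" where
      opeh: "\<And>n. openin X (h n)" and dish: "\<And>n. disjnt T (X closure_of (h n))"
      and Sh: "S \<subseteq> \<Union>(range h)"
      using cover[OF clo ST] by blast
    obtain k :: "nat \<Rightarrow> 'a set" where
      opek: "\<And>n. openin X (k n)" and disk: "\<And>n. disjnt S (X closure_of (k n))"
      and Tk: "T \<subseteq> \<Union>(range k)"
      using cover[OF clo(2,1)] ST disjnt_sym by blast
    \<comment> \<open>Subtracting only the closures with index up to \<open>i\<close> removes a
      closed set, so each piece stays open. A point common to pieces \<open>i\<close> of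
      \<open>U\<close> and \<open>j\<close> of \<open>V\<close> is excluded by whichever of the two
      was subtracted from the piece of larger index.\<close>
    define U where "U \<equiv> \<Union>i. h i - (\<Union>j\<le>i. X closure_of k j)"
    define V where "V \<equiv> \<Union>i. k i - (\<Union>j\<le>i. X closure_of h j)"
    show "\<exists>U V. openin X U \<and> openin X V \<and> S \<subseteq> U \<and> T \<subseteq> V \<and> disjnt U V"
    proof (intro exI conjI)
      show "openin X U" "openin X V"
        unfolding U_def V_def
        by (force intro!: opek opeh closedin_Union closedin_closure_of)+
      have "x \<notin> X closure_of k j" if "x \<in> S" for x j using that disk[of j] by (auto simp: disjnt_iff)
      with Sh show "S \<subseteq> U" unfolding U_def by (auto dest!: subsetD)
      have "x \<notin> X closure_of h j" if "x \<in> T" for x j using that dish[of j] by (auto simp: disjnt_iff)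
      with Tk show "T \<subseteq> V" unfolding V_def by (auto dest!: subsetD)
      have "False" if "x \<in> h i" "x \<in> k j" "\<forall>l\<le>i. x \<notin> X closure_of k l" "\<forall>l\<le>j. x \<notin> X closure_of h l" for x i j
      proof -
        have "x \<in> X closure_of h i" "x \<in> X closure_of k j"
          using that(1,2) closure_of_subset[OF openin_subset[OF opeh]]
            closure_of_subset[OF openin_subset[OF opek]] by blast+
        then show False using that by (meson linear)
      qed
      then show "disjnt U V"
        by (force simp: U_def V_def disjnt_iff)
    qed
  qed
qed

text \<open>Normality supplies a Urysohn function \<open>f m B\<close> for each basic set
  \<open>B\<close> and each \<open>m\<close>, vanishing off \<open>B\<close> and equal to 1 on a
  closed core of \<open>B\<close>. For fixed \<open>n\<close> and \<open>m\<close> only finitely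
  many of them are nonzero near a given point, which gives equicontinuity; the cores see every
  point, which gives separation.\<close>

theorem Nagata_Smirnov:
  fixes \<F> :: "nat \<Rightarrow> 'a set set"
  assumes reg: "regular_space X" and t1: "t1_space X"
    and lf: "\<And>n. locally_finite_family X (\<F> n)"
    and op: "\<And>n A. A \<in> \<F> n \<Longrightarrow> openin X A"
    and base: "\<And>U x. \<lbrakk>openin X U; x \<in> U\<rbrakk> \<Longrightarrow> \<exists>n. \<exists>A\<in>\<F> n. x \<in> A \<and> A \<subseteq> U"
  shows "metrizable_space X"
proof -
  have normal: "normal_space X"
    using regular_sigma_locally_finite_base_imp_normal_space[of X \<F>] assms by blast
  \<comment> \<open>All members of \<open>\<F> m\<close> with closure inside \<open>B\<close> are
    merged, so that \<open>B\<close> carries one function per \<open>m\<close> and not one per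
    member \<open>C\<close>; otherwise infinitely many functions could be nonzero near a point.
    Local finiteness keeps the closure of the merged set inside \<open>B\<close>.\<close>
  let ?core = "\<lambda>m B. X closure_of \<Union>{C \<in> \<F> m. X closure_of C \<subseteq> B}"
  have core: "?core m B \<subseteq> B" for m B
  proof -
    have "locally_finite_in X {C \<in> \<F> m. X closure_of C \<subseteq> B}"
    proof (rule locally_finite_in_subset)
      show "locally_finite_in X (\<F> m)"
        using lf op openin_subset by (blast intro: locally_finite_family_imp_in)
    qed auto
    then show ?thesis by (auto simp: closure_of_locally_finite_Union)
  qed
  define sep where "sep m B f \<longleftrightarrow> continuous_map X (top_of_set {0..1::real}) f \<and>
      f ` (topspace X - B) \<subseteq> {0} \<and> f ` ?core m B \<subseteq> {1}" for m B f
  have "\<exists>f. sep m B f" if "B \<in> \<F> n" for n m B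
  proof -
    have "closedin X (topspace X - B)" "disjnt (topspace X - B) (?core m B)"
      using op[OF that] core by (auto simp: disjnt_iff)
    then obtain f where "continuous_map X (top_of_set {0..1::real}) f"
      "f ` (topspace X - B) \<subseteq> {0}" "f ` ?core m B \<subseteq> {1}"
      by (rule Urysohn_lemma[OF normal _ closedin_closure_of, of _ _ 0 1]) auto
    then show ?thesis unfolding sep_def by blast
  qed
  then have sep: "sep m B (SOME f. sep m B f)" if "B \<in> \<F> n" for n m B
    unfolding some_eq_ex using that by blast
  define f where "f m B = (SOME f. sep m B f)" for m B
  have f: "continuous_map X (top_of_set {0..1::real}) (f m B) \<and>
      f m B ` (topspace X - B) \<subseteq> {0} \<and> f m B ` ?core m B \<subseteq> {1}" if "B \<in> \<F> n" for n m B
    using sep[OF that, of m] unfolding f_def[symmetric] unfolding sep_def .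
  have f01: "f m B x \<in> {0..1}" if "B \<in> \<F> n" "x \<in> topspace X" for n m B x
    using f[OF that(1), of m] that(2) by (auto simp: continuous_map_in_subtopology)
  \<comment> \<open>The weights make all but finitely many of the locally finite families negligible, hence equicontinuity.\<close>
  define g where "g i x = (if fst (snd i) \<in> \<F> (fst i) \<and> x \<in> topspace X
      then (1/2) ^ prod_encode (fst i, snd (snd i)) * f (snd (snd i)) (fst (snd i)) x else 0)"
    for i :: "nat \<times> 'a set \<times> nat" and x
  have g_eq: "g (n, B, m) x = (1/2) ^ prod_encode (n, m) * f m B x"
    if "B \<in> \<F> n" "x \<in> topspace X" for n B m x
    using that by (simp add: g_def)
  let ?I = "{(n, B, m :: nat). B \<in> \<F> n}"
  show ?thesis
  proof (rule metrizable_space_equicontinuous_family[where g = g and I = ?I])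
    show "t1_space X" by fact
    \<comment> \<open>The bound is required at all indices and all points, which is why
      \<open>g\<close> takes the value 0 outside its intended domain.\<close>
    show "g i x \<in> {0..1}" for i x
    proof (cases i)
      case (fields n B m)
      show ?thesis
      proof (cases "B \<in> \<F> n \<and> x \<in> topspace X")
        case True
        then show ?thesis
          using f01[of B n x m] g_eq[of B n x m] fields
          by (simp add: mult_le_one power_le_one)
      qed (auto simp: g_def fields)
    qed
  next
    fix x and e :: real assume x: "x \<in> topspace X" and e: "0 < e"
    have "\<exists>V. openin X V \<and> x \<in> V \<and> (\<forall>y\<in>V. \<forall>B\<in>\<F> n. \<bar>f m B x - f m B y\<bar> \<le> e)" for n m
    proof -
      obtain V where V: "openin X V" "x \<in> V" and fin: "finite {B\<in>\<F> n. B \<inter> V \<noteq> {}}"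
        using lf[of n] x unfolding locally_finite_family_def by blast
      let ?N = "\<lambda>B. {y \<in> topspace X. f m B y \<in> ball (f m B x) e}"
      \<comment> \<open>Functions whose set \<open>B\<close> misses \<open>V\<close> vanish on all
        of \<open>V\<close>; only the finitely many others shrink the neighbourhood.\<close>
      let ?V = "V \<inter> \<Inter>(insert (topspace X) (?N ` {B\<in>\<F> n. B \<inter> V \<noteq> {}}))"
      have "openin X (?N B)" if "B \<in> \<F> n" for B
        using f[OF that, of m] by (intro openin_continuous_map_preimage[where Y = euclideanreal])
          (auto simp: continuous_map_in_subtopology)
      then have "openin X ?V"
        using V fin by (intro openin_Int openin_Inter) auto
      moreover have "x \<in> ?V" using x V e by auto
      moreover have "\<bar>f m B x - f m B y\<bar> \<le> e" if y: "y \<in> ?V" and B: "B \<in> \<F> n" for y B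
      proof (cases "B \<inter> V = {}")
        case True
        then have "x \<in> topspace X - B" "y \<in> topspace X - B" using x y V by auto
        then have "f m B x = 0" "f m B y = 0" using f[OF B, of m] by blast+
        then show ?thesis using e by simp
      next
        case False
        then have "y \<in> ?N B" using y B by blast
        then show ?thesis by (simp add: dist_real_def)
      qed
      ultimately show ?thesis by (intro exI[of _ ?V]) blast
    qed
    then obtain V where V: "\<And>n m. openin X (V n m) \<and> x \<in> V n m"
      and Ve: "\<And>n m y B. \<lbrakk>y \<in> V n m; B \<in> \<F> n\<rbrakk> \<Longrightarrow> \<bar>f m B x - f m B y\<bar> \<le> e"
      by metis
    obtain N where N: "(1/2) ^ N < e"
      using real_arch_pow_inv[OF e, of "1/2"] by auto
    let ?W = "\<Inter>(insert (topspace X) ((\<lambda>(n, m). V n m) ` prod_decode ` {..<N}))"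
    show "\<exists>W. openin X W \<and> x \<in> W \<and> (\<forall>y\<in>W. \<forall>i\<in>?I. \<bar>g i x - g i y\<bar> \<le> e)"
    proof (intro exI conjI ballI)
      show "openin X ?W" using V by (intro openin_Inter) (auto split: prod.split)
      show "x \<in> ?W" using x V by (auto split: prod.split)
      fix y i assume y: "y \<in> ?W" and "i \<in> ?I"
      then obtain n B m where i: "i = (n, B, m)" and B: "B \<in> \<F> n" by auto
      have yX: "y \<in> topspace X" using y by simp
      have *: "\<bar>g i x - g i y\<bar> = (1/2) ^ prod_encode (n, m) * \<bar>f m B x - f m B y\<bar>"
        unfolding i g_eq[OF B x] g_eq[OF B yX]
        by (simp add: right_diff_distrib[symmetric] abs_mult)
      show "\<bar>g i x - g i y\<bar> \<le> e"
      proof (cases "prod_encode (n, m) < N")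
        case True
        then have "(n, m) \<in> prod_decode ` {..<N}"
          by (intro image_eqI[of _ _ "prod_encode (n, m)"]) auto
        then have "y \<in> V n m" using y by blast
        then have "\<bar>f m B x - f m B y\<bar> \<le> e" using Ve B by simp
        moreover have "\<bar>g i x - g i y\<bar> \<le> \<bar>f m B x - f m B y\<bar>"
          unfolding * by (intro mult_left_le_one_le) (auto simp: power_le_one)
        ultimately show ?thesis by linarith
      next
        case False
        have "\<bar>f m B x - f m B y\<bar> \<le> 1"
          using f01[OF B x, of m] f01[OF B yX, of m] by auto
        then have "\<bar>g i x - g i y\<bar> \<le> (1/2) ^ prod_encode (n, m)"
          unfolding * by (intro mult_left_le) auto
        also have "\<dots> \<le> (1/2) ^ N" using False by (intro power_decreasing) auto
        finally show ?thesis using N by linarith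
      qed
    qed
  next
    fix x U assume U: "openin X U" "x \<in> U"
    obtain n B where B: "B \<in> \<F> n" "x \<in> B" "B \<subseteq> U" using base[OF U] by blast
    obtain m C where C: "C \<in> \<F> m" "x \<in> C" "X closure_of C \<subseteq> B"
      using regular_space_closure_base[OF reg op[OF B(1)] B(2), of \<F>, OF base] by blast
    have xX: "x \<in> topspace X" using U openin_subset by blast
    have "\<Union>{C \<in> \<F> m. X closure_of C \<subseteq> B} \<subseteq> topspace X" using op openin_subset by blast
    then have "x \<in> ?core m B" using C closure_of_subset by blast
    then have fx: "f m B x = 1" using f[OF B(1), of m] by blast
    \<comment> \<open>The threshold is the weight itself: \<open>f m B\<close> is 1 at
      \<open>x\<close> and 0 off \<open>B\<close>, so at a point outside \<open>B\<close> the
      difference would be exactly the weight.\<close>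
    show "\<exists>i\<in>?I. \<exists>e>0. \<forall>y\<in>topspace X. \<bar>g i x - g i y\<bar> < e \<longrightarrow> y \<in> U"
    proof (intro bexI exI conjI ballI impI)
      show "(n, B, m) \<in> ?I" using B by simp
      show "0 < (1/2::real) ^ prod_encode (n, m)" by simp
      fix y assume y: "y \<in> topspace X" "\<bar>g (n, B, m) x - g (n, B, m) y\<bar> < (1/2) ^ prod_encode (n, m)"
      have "f m B y \<noteq> 0"
        using y(2) by (auto simp: g_eq[OF B(1) xX] g_eq[OF B(1) y(1)] fx)
      then have "y \<in> B" using f[OF B(1), of m] y(1) by blast
      then show "y \<in> U" using B by blast
    qed
  qed
qed

subsection \<open>Bases of metrizable spaces\<close>

text \<open>Stone's construction: for each radius \<open>r k\<close> the centres are well-ordered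
  and every point is assigned to the first ball containing it. Keeping only points with a margin
  \<open>r n\<close> inside that ball separates the classes uniformly, so small thickenings form a
  discrete family for each pair \<open>(k, n)\<close>.\<close>

lemma (in Metric_space) sigma_discrete_base:
  obtains \<F> :: "nat \<Rightarrow> 'a set set"
  where "\<And>n. locally_finite_family mtopology (\<F> n)"
    and "\<And>n A. A \<in> \<F> n \<Longrightarrow> openin mtopology A"
    and "\<And>U x. \<lbrakk>openin mtopology U; x \<in> U\<rbrakk> \<Longrightarrow> \<exists>n. \<exists>A\<in>\<F> n. x \<in> A \<and> A \<subseteq> U"
proof -
  obtain R :: "'a rel" where R: "Well_order R" "Field R = UNIV"
    using well_ordering[where 'a = 'a] by (elim exE conjE)
  let ?L = "R - Id"
  have wf: "wf ?L" using R unfolding well_order_on_def by blast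
  have total: "(a, b) \<in> ?L \<or> (b, a) \<in> ?L" if "a \<noteq> b" for a b
    using R that unfolding well_order_on_def linear_order_on_def total_on_def by blast
  define r :: "nat \<Rightarrow> real" where "r k = 1 / real (Suc k)" for k
  have r_pos: "r k > 0" for k by (simp add: r_def)
  have r_small: "\<exists>k. r k < e" if "e > 0" for e
    using nat_approx_posE[OF that] unfolding r_def by blast
  \<comment> \<open>Centres range over the whole type. One outside \<open>M\<close> has an empty
    ball, hence an empty \<open>T k n a\<close>.\<close>
  define T where "T k n a = {x \<in> M. mball x (r n) \<subseteq> mball a (r k) \<and> (\<forall>b. (b, a) \<in> ?L \<longrightarrow> x \<notin> mball b (r k))}"
    for k n a
  define E where "E k n a = (\<Union>x\<in>T k n a. mball x (r n / 3))" for k n a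
  \<comment> \<open>If \<open>a\<close> precedes \<open>b\<close>, the \<open>r n\<close>-ball about
    a point of \<open>T k n a\<close> lies in the ball about \<open>a\<close>, which
    \<open>T k n b\<close> avoids.\<close>
  have T_sep: "r n \<le> d x y" if x: "x \<in> T k n a" and y: "y \<in> T k n b" and "a \<noteq> b" for k n a b x y
  proof -
    have *: "r n \<le> d u v" if "u \<in> T k n a" "v \<in> T k n b" "(a, b) \<in> ?L" for u v a b
    proof -
      have "v \<notin> mball u (r n)" using that unfolding T_def by blast
      then show ?thesis using that by (auto simp: T_def)
    qed
    show ?thesis
      using total[OF \<open>a \<noteq> b\<close>] *[OF x y] *[OF y x] by (auto simp: commute)
  qed
  have E_unique: "a = b"
    if ab: "E k n a \<inter> mball z (r n / 6) \<noteq> {}" "E k n b \<inter> mball z (r n / 6) \<noteq> {}" for k n a b z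
  proof (rule ccontr)
    assume "a \<noteq> b"
    obtain u x where u: "x \<in> T k n a" "d x u < r n / 3" "d z u < r n / 6" and M: "x \<in> M" "u \<in> M" "z \<in> M"
      using ab(1) unfolding E_def by fastforce
    obtain v y where v: "y \<in> T k n b" "d y v < r n / 3" "d z v < r n / 6" and M': "y \<in> M" "v \<in> M"
      using ab(2) unfolding E_def by fastforce
    \<comment> \<open>The four terms are below \<open>r n / 3\<close>, \<open>r n / 6\<close>,
      \<open>r n / 6\<close> and \<open>r n / 3\<close>, whose sum is the separation
      \<open>r n\<close>.\<close>
    have "d x y \<le> d x u + d u z + d z v + d v y"
      using M M' triangle[of x u y] triangle[of u z y] triangle[of z v y] by linarith
    then show False
      using T_sep[OF u(1) v(1) \<open>a \<noteq> b\<close>] u v commute[of u z] commute[of v y] by linarith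
  qed
  define \<F> where "\<F> i = (case prod_decode i of (k, n) \<Rightarrow> range (E k n))" for i
  show ?thesis
  proof
    fix i
    obtain k n where kn: "prod_decode i = (k, n)" by fastforce
    show "locally_finite_family mtopology (\<F> i)"
      unfolding locally_finite_family_def
    proof
      fix z assume z: "z \<in> topspace mtopology"
      let ?V = "mball z (r n / 6)"
      have "{A \<in> \<F> i. A \<inter> ?V \<noteq> {}} \<subseteq> {E k n (SOME a. E k n a \<inter> ?V \<noteq> {})}"
      proof clarify
        fix A assume "A \<in> \<F> i" "A \<inter> ?V \<noteq> {}"
        then obtain a where a: "A = E k n a" "E k n a \<inter> ?V \<noteq> {}"
          by (auto simp: \<F>_def kn)
        then have "a = (SOME a. E k n a \<inter> ?V \<noteq> {})"
          using E_unique[of k n a z] someI[of "\<lambda>a. E k n a \<inter> ?V \<noteq> {}"] by blast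
        with a show "A = E k n (SOME a. E k n a \<inter> ?V \<noteq> {})" by simp
      qed
      then have "finite {A \<in> \<F> i. A \<inter> ?V \<noteq> {}}" by (rule finite_subset) simp
      moreover have "z \<in> ?V" using z r_pos by simp
      ultimately show "\<exists>V. openin mtopology V \<and> z \<in> V \<and> finite {A \<in> \<F> i. A \<inter> V \<noteq> {}}"
        using openin_mball by blast
    qed
    show "openin mtopology A" if "A \<in> \<F> i" for A
      using that by (auto simp: \<F>_def kn E_def)
  next
    fix U x assume U: "openin mtopology U" "x \<in> U"
    then obtain e where e: "e > 0" "mball x e \<subseteq> U" and x: "x \<in> M"
      unfolding openin_mtopology by blast
    obtain k where k: "r k < e / 2" using r_small[of "e / 2"] e by auto
    have "x \<in> {a. x \<in> mball a (r k)}" using x r_pos by simp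
    from wfE_min[OF wf this] obtain a where a: "x \<in> mball a (r k)"
      and least: "\<And>b. (b, a) \<in> ?L \<Longrightarrow> x \<notin> mball b (r k)"
      by (metis mem_Collect_eq)
    obtain \<delta> where \<delta>: "\<delta> > 0" "mball x \<delta> \<subseteq> mball a (r k)"
      using a openin_mball[of a "r k"] unfolding openin_mtopology by blast
    obtain n where n: "r n < \<delta>" using r_small[OF \<delta>(1)] by blast
    then have "mball x (r n) \<subseteq> mball a (r k)"
      using \<delta> mball_subset_concentric[of "r n" \<delta> x] by auto
    with least x have "x \<in> T k n a" by (simp add: T_def)
    then have "x \<in> E k n a" using x r_pos[of n] unfolding E_def by force
    moreover have "E k n a \<subseteq> mball a (r k)"
    proof -
      have "mball y (r n / 3) \<subseteq> mball a (r k)" if "y \<in> T k n a" for y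
      proof -
        have "mball y (r n / 3) \<subseteq> mball y (r n)" using r_pos[of n] by (intro mball_subset_concentric) simp
        then show ?thesis using that by (auto simp: T_def)
      qed
      then show ?thesis unfolding E_def by blast
    qed
    moreover have "mball a (r k) \<subseteq> mball x e"
      using a k by (intro mball_subset) (auto simp: commute)
    moreover have "E k n a \<in> \<F> (prod_encode (k, n))" by (simp add: \<F>_def)
    ultimately show "\<exists>i. \<exists>A\<in>\<F> i. x \<in> A \<and> A \<subseteq> U" using e(2) by (meson order_trans)
  qed
qed

lemma metrizable_imp_sigma_locally_finite_weak_base:
  assumes "metrizable_space X"
  shows "\<exists>P. weak_base X P \<and> sigma_locally_finite X (\<Union>x\<in>topspace X. P x)"
proof -
  obtain M d where "Metric_space M d" and X: "X = Metric_space.mtopology M d"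
    using assms unfolding metrizable_space_def by blast
  then interpret Metric_space M d by simp
  obtain \<F> :: "nat \<Rightarrow> 'a set set"
    where lf: "\<And>n. locally_finite_family X (\<F> n)"
    and op: "\<And>n A. A \<in> \<F> n \<Longrightarrow> openin X A"
    and base: "\<And>U x. \<lbrakk>openin X U; x \<in> U\<rbrakk> \<Longrightarrow> \<exists>n. \<exists>A\<in>\<F> n. x \<in> A \<and> A \<subseteq> U"
    by (rule sigma_discrete_base[folded X]) (rule that)
  let ?P = "\<lambda>x. {A \<in> (\<Union>n. \<F> n). x \<in> A}"
  have "weak_base X ?P"
    unfolding weak_base_def
  proof (intro conjI ballI allI impI)
    fix x A B assume A: "A \<in> ?P x" and B: "B \<in> ?P x"
    then have "openin X (A \<inter> B)" "x \<in> A \<inter> B" using op by auto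
    then show "\<exists>W\<in>?P x. W \<subseteq> A \<inter> B" using base by fastforce
  next
    fix x A assume "A \<in> ?P x"
    then show "x \<in> A" "A \<subseteq> topspace X" using op openin_subset by blast+
  next
    fix x U assume "openin X U \<and> x \<in> U"
    then show "\<exists>A\<in>?P x. A \<subseteq> U" using base by fastforce
  next
    fix G assume "G \<subseteq> topspace X \<and> (\<forall>x\<in>G. \<exists>A\<in>?P x. A \<subseteq> G)"
    then show "openin X G"
      using op by (subst openin_subopen) blast
  qed
  moreover have "sigma_locally_finite X (\<Union>x\<in>topspace X. ?P x)"
    unfolding sigma_locally_finite_def
  proof (intro exI conjI allI)
    \<comment> \<open>An empty member of some \<open>\<F> n\<close> contains no point and so belongs
      to no \<open>?P x\<close>; it has to be discarded for equality.\<close>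
    show "(\<Union>x\<in>topspace X. ?P x) = (\<Union>n. \<F> n - {{}})"
    proof (rule set_eqI)
      fix A
      have "A \<subseteq> topspace X" if "A \<in> \<F> n" for n using op[OF that] openin_subset by blast
      then show "A \<in> (\<Union>x\<in>topspace X. ?P x) \<longleftrightarrow> A \<in> (\<Union>n. \<F> n - {{}})" by auto
    qed
    have "locally_finite_family X \<G>" if \<H>: "locally_finite_family X \<H>" and "\<G> \<subseteq> \<H>" for \<G> \<H>
      unfolding locally_finite_family_def
    proof
      fix x assume "x \<in> topspace X"
      then obtain V where V: "openin X V" "x \<in> V" "finite {A\<in>\<H>. A \<inter> V \<noteq> {}}"
        using \<H> unfolding locally_finite_family_def by blast
      have "finite {A\<in>\<G>. A \<inter> V \<noteq> {}}"
        using that(2) by (intro finite_subset[OF _ V(3)]) blast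
      with V show "\<exists>V. openin X V \<and> x \<in> V \<and> finite {A\<in>\<G>. A \<inter> V \<noteq> {}}"
        by (intro exI[of _ V]) simp
    qed
    then show "locally_finite_family X (\<F> n - {{}})" for n using lf[of n] by blast
  qed
  ultimately show ?thesis by blast
qed

subsection \<open>The Vietoris topology\<close>

lemma topspace_vietoris: "topspace (vietoris X) = compacts_of X"
proof
  show "topspace (vietoris X) \<subseteq> compacts_of X"
    by (auto simp: vietoris_def vietoris_basic_def)
  have "vietoris_basic X [topspace X] \<in> {vietoris_basic X Us | Us. Us \<noteq> [] \<and> (\<forall>U\<in>set Us. openin X U)}"
    by force
  moreover have "compacts_of X \<subseteq> vietoris_basic X [topspace X]"
    using compactin_subset_topspace by (fastforce simp: vietoris_basic_def compacts_of_def)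
  ultimately show "compacts_of X \<subseteq> topspace (vietoris X)"
    by (auto simp: vietoris_def)
qed

lemma openin_vietoris_basic:
  assumes "Us \<noteq> []" "\<And>U. U \<in> set Us \<Longrightarrow> openin X U"
  shows "openin (vietoris X) (vietoris_basic X Us)"
  unfolding vietoris_def using assms by (intro topology_generated_by_Basis) blast

text \<open>Writing the Hausdorff distance as an infimum of admissible radii reduces the triangle
  inequality to adding radii. Compactness gives closedness, hence distance 0 only between equal
  sets; Lebesgue numbers, which make Vietoris basic sets metrically open; and finite nets, which
  make metrically open sets Vietoris open.\<close>

lemma metrizable_imp_metrizable_vietoris:
  fixes X :: "'a topology"
  assumes "metrizable_space X"
  shows "metrizable_space (vietoris X)"
proof -
  obtain M d where "Metric_space M d" and X: "X = Metric_space.mtopology M d"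
    using assms unfolding metrizable_space_def by blast
  then interpret Metric_space M d by simp
  define near where "near r K L \<longleftrightarrow> (\<forall>x\<in>K. \<exists>y\<in>L. d x y < r) \<and> (\<forall>y\<in>L. \<exists>x\<in>K. d x y < r)" for r K L
  \<comment> \<open>Allowing every \<open>r \<ge> 1\<close> caps the Hausdorff distance at 1 and keeps the set nonempty for all arguments.\<close>
  define S where "S K L = {r. 0 < r \<and> (1 \<le> r \<or> near r K L)}" for K L
  define D where "D K L = Inf (S K L)" for K L
  have near_mono: "near s K L" if "near r K L" "r \<le> s" for r s K L
    using that unfolding near_def by (meson less_le_trans)
  have near_sym: "near r K L \<longleftrightarrow> near r L K" for r K L
    unfolding near_def by (auto simp: commute)
  have near_trans: "near (r + s) K N"
    if "near r K L" "near s L N" "K \<subseteq> M" "L \<subseteq> M" "N \<subseteq> M" for r s K L N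
  proof -
    have *: "\<exists>z\<in>N. d x z < r + s"
      if KL: "near r K L" and LN: "near s L N" and M: "K \<subseteq> M" "L \<subseteq> M" "N \<subseteq> M" and x: "x \<in> K" for r s K L N x
    proof -
      obtain y where y: "y \<in> L" "d x y < r" using KL x unfolding near_def by blast
      then obtain z where "z \<in> N" "d y z < s" using LN unfolding near_def by blast
      moreover have "d x z \<le> d x y + d y z" using calculation y M x by (intro triangle) auto
      ultimately show ?thesis using y by (intro bexI[of _ z]) auto
    qed
    have "\<forall>x\<in>K. \<exists>z\<in>N. d x z < r + s" using * that by blast
    moreover have "\<forall>z\<in>N. \<exists>x\<in>K. d x z < r + s"
      using *[of s N L r K] that near_sym commute by (metis add.commute)
    ultimately show ?thesis unfolding near_def by blast
  qed
  have one: "1 \<in> S K L" for K L by (simp add: S_def)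
  have nonempty: "S K L \<noteq> {}" for K L using one by blast
  have bdd: "bdd_below (S K L)" for K L by (auto simp: S_def intro!: bdd_belowI[of _ 0])
  have D_le: "D K L \<le> r" if "r \<in> S K L" for K L r
    unfolding D_def by (rule cInf_lower[OF that bdd])
  have D_nonneg: "0 \<le> D K L" for K L
    unfolding D_def by (intro cInf_greatest nonempty) (auto simp: S_def)
  have S_above: "r \<in> S K L" if r: "D K L < r" for K L r
  proof -
    obtain s where "s \<in> S K L" "s < r"
      using cInf_lessD[OF nonempty] r unfolding D_def by blast
    then show ?thesis using near_mono[of s K L r] by (auto simp: S_def)
  qed
  have sub: "K \<subseteq> M" if "K \<in> compacts_of X" for K
    using that compactin_subset_topspace by (fastforce simp: compacts_of_def X)
  have S_add: "r + s \<in> S K N"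
    if "r \<in> S K L" "s \<in> S L N" "K \<in> compacts_of X" "L \<in> compacts_of X" "N \<in> compacts_of X" for r s K L N
    using that near_trans[of r K L s N] sub by (auto simp: S_def)
  have D_sub: "K \<subseteq> L" if K: "K \<in> compacts_of X" and L: "L \<in> compacts_of X" and 0: "D K L = 0" for K L
  proof
    fix x assume x: "x \<in> K"
    have "closedin mtopology L"
      using L compactin_imp_closedin[OF Hausdorff_space_mtopology] by (simp add: compacts_of_def X)
    moreover have "\<exists>y\<in>L. d x y < r" if "r > 0" for r
    proof -
      \<comment> \<open>The radius is kept below 1, where membership in \<open>S\<close> really
        means \<open>near\<close>.\<close>
      have "min r (1/2) \<in> S K L" using S_above that 0 by simp
      then have "near (min r (1/2)) K L" by (auto simp: S_def)
      then show ?thesis using x unfolding near_def by fastforce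
    qed
    ultimately show "x \<in> L"
      using x sub[OF K] unfolding closedin_metric disjnt_iff by (metis DiffI in_mball subsetD)
  qed
  have D_comm: "D K L = D L K" for K L
    unfolding D_def S_def using near_sym by metis
  interpret H: Metric_space "compacts_of X" D
  proof
    show "0 \<le> D K L" for K L by (rule D_nonneg)
    show "D K L = D L K" for K L by (rule D_comm)
    show "D K L = 0 \<longleftrightarrow> K = L" if K: "K \<in> compacts_of X" and L: "L \<in> compacts_of X" for K L
    proof
      assume "D K L = 0"
      then show "K = L" using D_sub[OF K L] D_sub[OF L K] D_comm by (metis subset_antisym)
    next
      assume "K = L"
      then have "near r K L" if "r > 0" for r
        using that sub[OF K] unfolding near_def by (metis mdist_zero subsetD)
      then have "r \<in> S K L" if "r > 0" for r using that by (simp add: S_def)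
      then have "D K L \<le> r" if "r > 0" for r using that D_le by blast
      then show "D K L = 0" using D_nonneg[of K L] by (meson dense_ge order_antisym)
    qed
    show "D K N \<le> D K L + D L N"
      if K: "K \<in> compacts_of X" and L: "L \<in> compacts_of X" and N: "N \<in> compacts_of X" for K L N
    proof (rule field_le_epsilon)
      fix e :: real assume "e > 0"
      then have r: "D K L + e/2 \<in> S K L" and s: "D L N + e/2 \<in> S L N" by (auto intro: S_above)
      have "(D K L + e/2) + (D L N + e/2) \<in> S K N"
        using S_add[OF r s K L N] .
      then show "D K N \<le> D K L + D L N + e" using D_le by fastforce
    qed
  qed
  have "openin (vietoris X) U \<longleftrightarrow> openin H.mtopology U" for U
  proof
    have "\<exists>r>0. H.mball K r \<subseteq> vietoris_basic X Us"
      if Us: "\<forall>U\<in>set Us. openin X U" and K: "K \<in> vietoris_basic X Us" for Us K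
    proof -
      have Kc: "K \<in> compacts_of X" and KU: "K \<subseteq> \<Union>(set Us)" and meet: "\<And>U. U \<in> set Us \<Longrightarrow> K \<inter> U \<noteq> {}"
        using K by (auto simp: vietoris_basic_def)
      \<comment> \<open>The Lebesgue number controls the covering condition for sets close to
        \<open>K\<close>; the balls about the points \<open>p U\<close> chosen next control the
        condition of meeting each \<open>U\<close>.\<close>
      obtain e where e: "e > 0" and Leb: "\<And>x. x \<in> K \<Longrightarrow> \<exists>U\<in>set Us. mball x e \<subseteq> U"
        using lebesgue_number[of K "set Us"] Kc KU Us unfolding compacts_of_def X by blast
      have "\<exists>p\<in>K. \<exists>r>0. mball p r \<subseteq> U" if "U \<in> set Us" for U
        using meet[OF that] Us that unfolding X openin_mtopology by blast
      then obtain p \<rho> where p: "\<And>U. U \<in> set Us \<Longrightarrow> p U \<in> K \<and> \<rho> U > 0 \<and> mball (p U) (\<rho> U) \<subseteq> U"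
        by metis
      \<comment> \<open>The entry 1 ensures that a radius below \<open>r\<close> lies in
        \<open>S\<close> only by way of \<open>near\<close>.\<close>
      define r where "r = Min (insert (1::real) (insert e (\<rho> ` set Us)))"
      have r: "r \<le> 1" "r \<le> e" "\<And>U. U \<in> set Us \<Longrightarrow> r \<le> \<rho> U"
        unfolding r_def by (intro Min_le; simp)+
      have "r > 0" using e p by (simp add: r_def)
      have "H.mball K r \<subseteq> vietoris_basic X Us"
      proof
        fix L assume "L \<in> H.mball K r"
        then have Lc: "L \<in> compacts_of X" and "D K L < r" by auto
        then obtain s where "s < r" "s \<in> S K L"
          using S_above dense by meson
        then have "near s K L" using r by (auto simp: S_def)
        then have near: "near r K L" using near_mono \<open>s < r\<close> by (meson less_imp_le)
        have "y \<in> \<Union>(set Us)" if y: "y \<in> L" for y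
        proof -
          obtain x where x: "x \<in> K" "d x y < r" using near y unfolding near_def by blast
          then have "y \<in> mball x e" using sub[OF Kc] sub[OF Lc] r y by auto
          then show ?thesis using Leb[OF x(1)] by blast
        qed
        moreover have "L \<inter> U \<noteq> {}" if U: "U \<in> set Us" for U
        proof -
          obtain y where y: "y \<in> L" "d (p U) y < r" using near p[OF U] unfolding near_def by blast
          then have "y \<in> mball (p U) (\<rho> U)" using sub[OF Kc] sub[OF Lc] r(3)[OF U] p[OF U] by auto
          then show ?thesis using y p[OF U] by blast
        qed
        ultimately show "L \<in> vietoris_basic X Us" using Lc by (auto simp: vietoris_basic_def)
      qed
      with \<open>r > 0\<close> show ?thesis by blast
    qed
    then have "openin H.mtopology (vietoris_basic X Us)" if "\<forall>U\<in>set Us. openin X U" for Us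
      using that by (auto simp: H.openin_mtopology vietoris_basic_def)
    then have basic: "openin H.mtopology B"
      if "B \<in> {vietoris_basic X Us | Us. Us \<noteq> [] \<and> (\<forall>U\<in>set Us. openin X U)}" for B
      using that by blast
    assume "openin (vietoris X) U"
    then have gen: "generate_topology_on {vietoris_basic X Us | Us. Us \<noteq> [] \<and> (\<forall>U\<in>set Us. openin X U)} U"
      unfolding vietoris_def openin_topology_generated_by_iff .
    show "openin H.mtopology U"
      by (rule generate_topology_on_coarsest[OF istopology_openin _ gen]) (rule basic)
  next
    assume U: "openin H.mtopology U"
    show "openin (vietoris X) U"
    proof (subst openin_subopen, intro strip)
      fix K assume K: "K \<in> U"
      then have Kc: "K \<in> compacts_of X" using U by (auto simp: H.openin_mtopology)
      obtain r where r: "r > 0" "H.mball K r \<subseteq> U" using U K unfolding H.openin_mtopology by blast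
      have "mtotally_bounded K"
        using Kc compactin_imp_mtotally_bounded by (simp add: compacts_of_def X)
      \<comment> \<open>The centres lie in \<open>K\<close>, so \<open>K\<close> meets every ball of
        the net. A set \<open>L\<close> that meets every ball and is covered by them has each point
        of \<open>K\<close> within \<open>2 * r / 3\<close> of \<open>L\<close> and each of its own
        points within \<open>r / 3\<close> of \<open>K\<close>.\<close>
      then obtain F where F: "finite F" "F \<subseteq> K" "K \<subseteq> (\<Union>x\<in>F. mball x (r/3))"
        unfolding mtotally_bounded_def using r by (metis divide_pos_pos zero_less_numeral)
      obtain xs where xs: "set xs = F" using finite_list[OF F(1)] by blast
      let ?Us = "map (\<lambda>x. mball x (r/3)) xs"
      have "F \<noteq> {}" using F Kc by (auto simp: compacts_of_def)
      then have "openin (vietoris X) (vietoris_basic X ?Us)"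
        using xs by (intro openin_vietoris_basic) (auto simp: X)
      moreover have "K \<in> vietoris_basic X ?Us"
        using Kc F xs sub[OF Kc] r by (force simp: vietoris_basic_def)
      moreover have "vietoris_basic X ?Us \<subseteq> H.mball K r"
      proof
        fix L assume L: "L \<in> vietoris_basic X ?Us"
        then have Lc: "L \<in> compacts_of X" by (simp add: vietoris_basic_def)
        have "\<exists>y\<in>L. d x y < 2 * r / 3" if x: "x \<in> K" for x
        proof -
          obtain p where p: "p \<in> F" "x \<in> mball p (r/3)" using F x by blast
          then obtain y where y: "y \<in> L" "y \<in> mball p (r/3)"
            using L xs by (force simp: vietoris_basic_def)
          have "d x y < 2 * r / 3" using p(2) y(2) triangle[of x p y] commute[of x p] by auto
          with y show ?thesis by blast
        qed
        moreover have "\<exists>x\<in>K. d x y < 2 * r / 3" if y: "y \<in> L" for y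
        proof -
          have "L \<subseteq> (\<Union>x\<in>F. mball x (r/3))" using L by (simp add: vietoris_basic_def xs)
          then obtain p where "p \<in> F" "y \<in> mball p (r/3)" using y by blast
          then show ?thesis using F r by (intro bexI[of _ p]) auto
        qed
        ultimately have "2 * r / 3 \<in> S K L" using r by (simp add: S_def near_def)
        then have "D K L \<le> 2 * r / 3" by (rule D_le)
        then show "L \<in> H.mball K r" using r Kc Lc by simp
      qed
      ultimately show "\<exists>T. openin (vietoris X) T \<and> K \<in> T \<and> T \<subseteq> U" using r by blast
    qed
  qed
  then have "vietoris X = H.mtopology" by (simp add: topology_eq)
  then show ?thesis using H.metrizable_space_mtopology by simp
qed

subsection \<open>Weak bases\<close>

lemma
  assumes "weak_base Y P"
  shows weak_base_mem: "\<lbrakk>y \<in> topspace Y; A \<in> P y\<rbrakk> \<Longrightarrow> y \<in> A"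
    and weak_base_subset: "\<lbrakk>y \<in> topspace Y; A \<in> P y\<rbrakk> \<Longrightarrow> A \<subseteq> topspace Y"
    and weak_base_Int: "\<lbrakk>y \<in> topspace Y; A \<in> P y; B \<in> P y\<rbrakk> \<Longrightarrow> \<exists>W\<in>P y. W \<subseteq> A \<inter> B"
  using assms unfolding weak_base_def by simp_all

lemma weak_base_small:
  assumes "weak_base Y P" "openin Y U" "y \<in> U"
  shows "\<exists>A\<in>P y. A \<subseteq> U"
proof -
  have "y \<in> topspace Y" using assms openin_subset by blast
  then have "\<forall>U. openin Y U \<and> y \<in> U \<longrightarrow> (\<exists>A\<in>P y. A \<subseteq> U)"
    using assms(1) unfolding weak_base_def by simp
  with assms show ?thesis by blast
qed

lemma weak_base_openin:
  assumes "weak_base Y P" "G \<subseteq> topspace Y" "\<And>y. y \<in> G \<Longrightarrow> \<exists>A\<in>P y. A \<subseteq> G"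
  shows "openin Y G"
  using assms unfolding weak_base_def by simp

section \<open>Separation and continuity in the hyperspace\<close>

lemma Hausdorff_space_vietoris:
  assumes X: "Hausdorff_space X"
  shows "Hausdorff_space (vietoris X)"
proof -
  have sep: "\<exists>U V. openin (vietoris X) U \<and> openin (vietoris X) V \<and> K \<in> U \<and> L \<in> V \<and> disjnt U V"
    if K: "K \<in> compacts_of X" and L: "L \<in> compacts_of X" and p: "p \<in> K" "p \<notin> L" for K L p
  proof -
    have "compactin X {p}" "compactin X L" "disjnt {p} L"
      using K L p compactin_subset_topspace by (fastforce simp: compacts_of_def)+
    then obtain U V where UV: "openin X U" "openin X V" "{p} \<subseteq> U" "L \<subseteq> V" "disjnt U V"
      using Hausdorff_space_compact_separation[OF X] by metis
    \<comment> \<open>The entry \<open>topspace X\<close> makes the covering condition vacuous, so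
      \<open>?A\<close> consists of the compact sets that meet \<open>U\<close>, while
      \<open>?B\<close> consists of those inside \<open>V\<close>.\<close>
    let ?A = "vietoris_basic X [topspace X, U]" and ?B = "vietoris_basic X [V]"
    have "openin (vietoris X) ?A" "openin (vietoris X) ?B"
      using UV by (auto intro!: openin_vietoris_basic)
    moreover have "K \<in> ?A"
      using K UV p compactin_subset_topspace[of X K] by (auto simp: vietoris_basic_def compacts_of_def)
    moreover have "L \<in> ?B" using L UV by (auto simp: vietoris_basic_def compacts_of_def)
    moreover have "disjnt ?A ?B" using UV(5) by (auto simp: vietoris_basic_def disjnt_iff)
    ultimately show ?thesis by blast
  qed
  show ?thesis
    unfolding Hausdorff_space_def topspace_vietoris
  proof clarify
    fix K L assume K: "K \<in> compacts_of X" and L: "L \<in> compacts_of X" and "K \<noteq> L"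
    then consider p where "p \<in> K" "p \<notin> L" | p where "p \<in> L" "p \<notin> K" by blast
    then show "\<exists>U V. openin (vietoris X) U \<and> openin (vietoris X) V \<and> K \<in> U \<and> L \<in> V \<and> disjnt U V"
    proof cases
      case 1
      then show ?thesis using sep[OF K L] by blast
    next
      case 2
      from sep[OF L K this] show ?thesis using disjnt_sym by metis
    qed
  qed
qed

text \<open>With \<open>C\<close> empty this is the embedding by singletons; with \<open>C\<close> a
  convergent sequence and its limit it is the collapsing map of the diagonal argument.\<close>

lemma continuous_map_insert_vietoris:
  assumes C: "compactin X C"
  shows "continuous_map X (vietoris X) (\<lambda>z. insert z C)"
proof -
  have comp: "insert z C \<in> compacts_of X" if "z \<in> topspace X" for z
    using compactin_Un[of X "{z}" C] C that by (simp add: compacts_of_def)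
  show ?thesis
    unfolding vietoris_def
  proof (rule continuous_on_generated_topo)
    fix B assume "B \<in> {vietoris_basic X Us | Us. Us \<noteq> [] \<and> (\<forall>U\<in>set Us. openin X U)}"
    then obtain Us where B: "B = vietoris_basic X Us" and Us: "\<And>U. U \<in> set Us \<Longrightarrow> openin X U" by blast
    show "openin X ((\<lambda>z. insert z C) -` B \<inter> topspace X)"
    proof (cases "C \<subseteq> \<Union>(set Us)")
      case True
      \<comment> \<open>Once \<open>C\<close> is covered, the added point has only to lie in the
        union and in every listed set that \<open>C\<close> misses.\<close>
      let ?W = "\<Inter>(insert (topspace X) (insert (\<Union>(set Us)) {U \<in> set Us. C \<inter> U = {}}))"
      have "(\<lambda>z. insert z C) -` B \<inter> topspace X = ?W"
        using True comp by (auto simp: B vietoris_basic_def)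
      moreover have "openin X ?W" using Us by (intro openin_Inter) auto
      ultimately show ?thesis by metis
    next
      case False
      then have "(\<lambda>z. insert z C) -` B \<inter> topspace X = {}" by (auto simp: B vietoris_basic_def)
      then show ?thesis by simp
    qed
  next
    have "(\<lambda>z. insert z C) ` topspace X \<subseteq> topspace (vietoris X)"
      using comp by (auto simp: topspace_vietoris)
    then show "(\<lambda>z. insert z C) ` topspace X \<subseteq> \<Union>{vietoris_basic X Us | Us. Us \<noteq> [] \<and> (\<forall>U\<in>set Us. openin X U)}"
      by (simp add: vietoris_def)
  qed
qed

lemma continuous_map_sing_vietoris: "continuous_map X (vietoris X) (\<lambda>x. {x})"
  using continuous_map_insert_vietoris[of X "{}"] by simp

lemma metrizable_vietoris_imp_metrizable:
  assumes "metrizable_space (vietoris X)"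
  shows "metrizable_space X"
proof -
  let ?Y = "subtopology (vietoris X) ((\<lambda>x. {x}) ` topspace X)"
  have "openin ?Y ((\<lambda>x. {x}) ` U)" if U: "openin X U" for U
  proof -
    have "(\<lambda>x. {x}) ` U = vietoris_basic X [U] \<inter> (\<lambda>x. {x}) ` topspace X"
      using openin_subset[OF U] by (auto simp: vietoris_basic_def compacts_of_def)
    then show ?thesis
      using openin_vietoris_basic[of "[U]" X] U by (auto simp: openin_subtopology)
  qed
  then have "open_map X ?Y (\<lambda>x. {x})" by (simp add: open_map_def)
  moreover have "continuous_map X ?Y (\<lambda>x. {x})"
    using continuous_map_sing_vietoris by (auto simp: continuous_map_in_subtopology)
  moreover have "(\<lambda>x. {x}) ` topspace X = topspace ?Y"
    by (auto simp: topspace_vietoris compacts_of_def)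
  ultimately have "homeomorphic_map X ?Y (\<lambda>x. {x})"
    by (intro bijective_open_imp_homeomorphic_map) auto
  then have "X homeomorphic_space ?Y" by (rule homeomorphic_map_imp_homeomorphic_space)
  then show ?thesis
    using metrizable_space_subtopology[OF assms] homeomorphic_metrizable_space by blast
qed

section \<open>Countable weak bases and convergent sequences\<close>

text \<open>Every member of \<open>P y\<close> contains \<open>y\<close>, and local finiteness at
  \<open>y\<close> allows only finitely many such sets in each \<open>\<F> n\<close>.\<close>

lemma countable_weak_base_at:
  assumes "sigma_locally_finite Y (\<Union>y\<in>topspace Y. P y)" and wb: "weak_base Y P" and y: "y \<in> topspace Y"
  shows "countable (P y)"
proof -
  obtain \<F> :: "nat \<Rightarrow> 'a set set" where \<F>: "(\<Union>y\<in>topspace Y. P y) = (\<Union>n. \<F> n)"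
    and lf: "\<And>n. locally_finite_family Y (\<F> n)"
    using assms(1) unfolding sigma_locally_finite_def by blast
  have "finite {A \<in> \<F> n. y \<in> A}" for n
  proof -
    obtain V where V: "y \<in> V" "finite {A \<in> \<F> n. A \<inter> V \<noteq> {}}"
      using lf[of n] y unfolding locally_finite_family_def by blast
    show ?thesis using V(1) by (intro finite_subset[OF _ V(2)]) blast
  qed
  then have "countable (\<Union>n. {A \<in> \<F> n. y \<in> A})" by (intro countable_UN) (auto intro: countable_finite)
  moreover have "P y \<subseteq> (\<Union>n. {A \<in> \<F> n. y \<in> A})"
    using \<F> y weak_base_mem[OF wb y] by blast
  ultimately show ?thesis by (rule countable_subset[rotated])
qed

lemma weak_base_decreasing_sequence:
  assumes wb: "weak_base Y P" and y: "y \<in> topspace Y" and "countable (P y)"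
  obtains Q :: "nat \<Rightarrow> 'a set"
  where "\<And>n. Q n \<in> P y" "\<And>m n. m \<le> n \<Longrightarrow> Q n \<subseteq> Q m" "\<And>U. \<lbrakk>openin Y U; y \<in> U\<rbrakk> \<Longrightarrow> \<exists>n. Q n \<subseteq> U"
proof -
  note dir = weak_base_Int[OF wb y] and small = weak_base_small[OF wb]
  have ne: "P y \<noteq> {}" using small[of "topspace Y"] y by auto
  define e where "e = from_nat_into (P y)"
  have e: "e n \<in> P y" for n using from_nat_into[OF ne] by (simp add: e_def)
  have "\<exists>Q. \<forall>n. (Q n \<in> P y \<and> Q n \<subseteq> e n) \<and> Q (Suc n) \<subseteq> Q n"
  proof (rule dependent_nat_choice)
    show "\<exists>A. A \<in> P y \<and> A \<subseteq> e 0" using e by blast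
    show "\<exists>B. (B \<in> P y \<and> B \<subseteq> e (Suc n)) \<and> B \<subseteq> A" if "A \<in> P y \<and> A \<subseteq> e n" for A n
      using dir[of A "e (Suc n)"] that e by blast
  qed
  then obtain Q where Q: "\<And>n. Q n \<in> P y" "\<And>n. Q n \<subseteq> e n" "\<And>n. Q (Suc n) \<subseteq> Q n" by blast
  show ?thesis
  proof (rule that[of Q])
    show "Q n \<in> P y" for n by (rule Q)
    show "Q n \<subseteq> Q m" if "m \<le> n" for m n using lift_Suc_antimono_le[of Q, OF Q(3) that] .
    show "\<exists>n. Q n \<subseteq> U" if U: "openin Y U" "y \<in> U" for U
    proof -
      obtain A where A: "A \<in> P y" "A \<subseteq> U" using small[OF U] by blast
      then obtain n where "e n = A"
        using from_nat_into_surj[OF \<open>countable (P y)\<close>] unfolding e_def by blast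
      then show ?thesis using Q(2) A by blast
    qed
  qed
qed

text \<open>Members of a weak base need not be neighbourhoods, but they absorb convergent sequences.
  Deleting the terms outside \<open>A\<close> leaves an open set: at \<open>y\<close> the set
  \<open>A\<close> itself witnesses this, and any other point is separated from a tail, so that only
  finitely many terms matter there.\<close>

lemma weak_base_eventually:
  assumes Y: "Hausdorff_space Y" and wb: "weak_base Y P" and lim: "limitin Y s y sequentially" and A: "A \<in> P y"
  shows "\<forall>\<^sub>F n in sequentially. s n \<in> A"
proof -
  have y: "y \<in> topspace Y" using lim by (simp add: limitin_def)
  note yA = weak_base_mem[OF wb y A] and small = weak_base_small[OF wb]
  let ?G = "topspace Y - {s n | n. s n \<notin> A}"
  have "\<exists>B\<in>P z. B \<subseteq> ?G" if z: "z \<in> ?G" for z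
  proof (cases "z = y")
    case True
    have "A \<subseteq> ?G" using weak_base_subset[OF wb y A] by blast
    with A True show ?thesis by blast
  next
    case False
    have zY: "z \<in> topspace Y" using z by blast
    obtain U V where UV: "openin Y U" "openin Y V" "z \<in> U" "y \<in> V" "disjnt U V"
      using Y zY y False unfolding Hausdorff_space_def by blast
    obtain N where N: "\<And>n. N \<le> n \<Longrightarrow> s n \<in> V"
      using lim UV unfolding limitin_sequentially by blast
    \<comment> \<open>Early terms may lie outside the space, hence the intersection with
      \<open>topspace Y\<close>.\<close>
    let ?E = "{s n | n. n < N \<and> s n \<notin> A} \<inter> topspace Y"
    have "closedin Y ?E"
      by (rule closedin_Hausdorff_finite[OF Y]) auto
    then have "openin Y (U - ?E)" using UV by (intro openin_diff)
    moreover have "z \<in> U - ?E" using z UV by blast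
    moreover have "U - ?E \<subseteq> ?G"
    proof
      fix u assume u: "u \<in> U - ?E"
      then have uY: "u \<in> topspace Y" using UV openin_subset by blast
      have False if n: "u = s n" "s n \<notin> A" for n
      proof (cases "n < N")
        case True
        then show ?thesis using n u uY by blast
      next
        case False
        then have "u \<in> V" using N[of n] n by simp
        then show ?thesis using u UV(5) by (auto simp: disjnt_iff)
      qed
      then show "u \<in> ?G" using uY by blast
    qed
    ultimately show ?thesis using small by (meson order_trans)
  qed
  then have "openin Y ?G" by (intro weak_base_openin[OF wb]) auto
  moreover have "y \<in> ?G" using y yA by blast
  ultimately have "\<forall>\<^sub>F n in sequentially. s n \<in> ?G" using lim unfolding limitin_def by blast
  then show ?thesis by (rule eventually_mono) blast
qed

section \<open>The diagonal argument\<close>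

lemma diagonal_convergence:
  fixes xx :: "nat \<Rightarrow> nat \<Rightarrow> 'a"
  assumes X: "Hausdorff_space X" and wb: "weak_base (vietoris X) P"
    and cnt: "\<And>K. K \<in> topspace (vietoris X) \<Longrightarrow> countable (P K)"
    and lim: "limitin X xs z sequentially" and xs: "\<And>n. xs n \<noteq> z"
    and lims: "\<And>n. limitin X (xx n) (xs n) sequentially"
  obtains m where "limitin X (\<lambda>n. xx n (m n)) z sequentially"
proof -
  let ?C = "insert z (range xs)"
  have z: "z \<in> topspace X" and xsX: "xs n \<in> topspace X" for n
    using lim lims by (auto simp: limitin_def)
  have comp: "compactin X ?C"
    using xsX by (intro compactin_sequence_with_limit[OF lim]) auto
  then have CY: "?C \<in> topspace (vietoris X)" by (simp add: topspace_vietoris compacts_of_def)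
  obtain Q :: "nat \<Rightarrow> _" where Q: "\<And>n. Q n \<in> P ?C" and dec: "\<And>m n. m \<le> n \<Longrightarrow> Q n \<subseteq> Q m"
    and small: "\<And>U. \<lbrakk>openin (vietoris X) U; ?C \<in> U\<rbrakk> \<Longrightarrow> \<exists>n. Q n \<subseteq> U"
    using weak_base_decreasing_sequence[OF wb CY cnt[OF CY]] by blast
  have evQ: "\<forall>\<^sub>F m in sequentially. insert (xx n m) ?C \<in> Q n" for n
  proof (rule weak_base_eventually[OF Hausdorff_space_vietoris[OF X] wb _ Q])
    have "limitin (vietoris X) ((\<lambda>x. insert x ?C) \<circ> xx n) (insert (xs n) ?C) sequentially"
      by (rule continuous_map_limit[OF continuous_map_insert_vietoris[OF comp] lims])
    \<comment> \<open>This is the collapse: for every \<open>n\<close> the sets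
      \<open>insert (xx n m) ?C\<close> converge to the same point \<open>?C\<close> of the
      hyperspace.\<close>
    moreover have "insert (xs n) ?C = ?C" by auto
    ultimately show "limitin (vietoris X) (\<lambda>m. insert (xx n m) ?C) ?C sequentially"
      by (simp add: o_def)
  qed
  have "\<exists>U W. openin X U \<and> openin X W \<and> xs i \<in> U \<and> z \<in> W \<and> disjnt U W" for i
    using X xsX z xs unfolding Hausdorff_space_def by blast
  then obtain U W where U: "\<And>i. openin X (U i)" "\<And>i. xs i \<in> U i"
    and W: "\<And>i. openin X (W i)" "\<And>i. z \<in> W i" and UW: "\<And>i. disjnt (U i) (W i)"
    by metis
  \<comment> \<open>The condition is an implication because \<open>xs n\<close> lies in
    \<open>W i\<close> only for large \<open>n\<close>. Restricting to \<open>i \<le> n\<close>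
    leaves finitely many requirements on \<open>m\<close>, yet every fixed \<open>i\<close> is
    eventually included.\<close>
  have evW: "\<forall>\<^sub>F m in sequentially. \<forall>i\<in>{..n}. xs n \<in> W i \<longrightarrow> xx n m \<in> W i" for n
  proof (rule eventually_ball_finite)
    show "\<forall>i\<in>{..n}. \<forall>\<^sub>F m in sequentially. xs n \<in> W i \<longrightarrow> xx n m \<in> W i"
      using lims[of n] W(1) unfolding limitin_def by (auto elim: eventually_mono)
  qed simp
  have "\<exists>m. insert (xx n m) ?C \<in> Q n \<and> (\<forall>i\<in>{..n}. xs n \<in> W i \<longrightarrow> xx n m \<in> W i)" for n
    using eventually_happens'[OF _ eventually_conj[OF evQ evW]] by simp
  then obtain m where mQ: "\<And>n. insert (xx n (m n)) ?C \<in> Q n"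
    and mW: "\<And>n i. \<lbrakk>i \<le> n; xs n \<in> W i\<rbrakk> \<Longrightarrow> xx n (m n) \<in> W i"
    by (metis atMost_iff)
  have "limitin X (\<lambda>n. xx n (m n)) z sequentially"
    unfolding limitin_def
  proof (intro conjI allI impI z)
    fix V assume V: "openin X V \<and> z \<in> V"
    then obtain j where j: "\<And>n. j \<le> n \<Longrightarrow> xs n \<in> V"
      using lim unfolding limitin_sequentially by blast
    \<comment> \<open>\<open>?O\<close> covers \<open>?C\<close>: the tail and the limit lie in
      \<open>V\<close>, the first \<open>j\<close> terms in their sets \<open>U i\<close>.
      Membership in \<open>Q N\<close> forces the chosen points into \<open>?O\<close>, and their
      membership in \<open>W i\<close> for \<open>i < j\<close> rules out the sets
      \<open>U i\<close>, leaving \<open>V\<close>.\<close>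
    let ?O = "V \<union> (\<Union>i<j. U i)"
    have "openin (vietoris X) (vietoris_basic X [?O])"
      using V U by (intro openin_vietoris_basic) auto
    moreover have "xs n \<in> ?O" for n using j[of n] U(2)[of n] by (cases "j \<le> n") auto
    then have "?C \<in> vietoris_basic X [?O]"
      using CY V by (auto simp: vietoris_basic_def topspace_vietoris)
    ultimately obtain N where N: "Q N \<subseteq> vietoris_basic X [?O]" using small by blast
    have "\<forall>\<^sub>F n in sequentially. \<forall>i\<in>{..<j}. xs n \<in> W i"
      using lim W unfolding limitin_def by (intro eventually_ball_finite) auto
    moreover have "\<forall>\<^sub>F n in sequentially. j \<le> n" "\<forall>\<^sub>F n in sequentially. N \<le> n"
      by (rule eventually_ge_at_top)+
    ultimately show "\<forall>\<^sub>F n in sequentially. xx n (m n) \<in> V"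
    proof eventually_elim
      case (elim n)
      have "insert (xx n (m n)) ?C \<in> vietoris_basic X [?O]" using mQ dec[OF elim(3)] N by blast
      then have "xx n (m n) \<in> ?O" by (auto simp: vietoris_basic_def)
      moreover have "xx n (m n) \<notin> U i" if "i < j" for i
        using mW[of i n] elim that UW[of i] by (auto simp: disjnt_iff)
      ultimately show ?case by blast
    qed
  qed
  then show ?thesis by (rule that)
qed

section \<open>From a weak base of the hyperspace to a base of the space\<close>

text \<open>Traces of a weak base form a weak base on a closed subspace, though not on an arbitrary
  one. The Hausdorff property makes the singletons closed in the hyperspace.\<close>

lemma weak_base_sing_vietoris:
  assumes X: "Hausdorff_space X" and wb: "weak_base (vietoris X) P"
  shows "weak_base X (\<lambda>x. (\<lambda>A. {z. {z} \<in> A}) ` P {x})"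
proof -
  have sing: "{x} \<in> topspace (vietoris X) \<longleftrightarrow> x \<in> topspace X" for x
    by (simp add: topspace_vietoris compacts_of_def)
  show ?thesis
    unfolding weak_base_def
  proof (intro conjI ballI allI impI)
    fix x A assume "x \<in> topspace X" "A \<in> (\<lambda>A. {z. {z} \<in> A}) ` P {x}"
    then show "x \<in> A" "A \<subseteq> topspace X"
      using weak_base_mem[OF wb, of "{x}"] weak_base_subset[OF wb, of "{x}"] sing by blast+
  next
    fix x A B assume "x \<in> topspace X" and A: "A \<in> (\<lambda>A. {z. {z} \<in> A}) ` P {x}" and B: "B \<in> (\<lambda>A. {z. {z} \<in> A}) ` P {x}"
    then obtain A' B' where AB: "A' \<in> P {x}" "B' \<in> P {x}" "A = {z. {z} \<in> A'}" "B = {z. {z} \<in> B'}" by blast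
    then obtain W where "W \<in> P {x}" "W \<subseteq> A' \<inter> B'" using weak_base_Int[OF wb, of "{x}"] sing \<open>x \<in> topspace X\<close> by blast
    then show "\<exists>W\<in>(\<lambda>A. {z. {z} \<in> A}) ` P {x}. W \<subseteq> A \<inter> B"
      using AB by (intro bexI[of _ "{z. {z} \<in> W}"]) auto
  next
    fix x U assume x: "x \<in> topspace X" and U: "openin X U \<and> x \<in> U"
    then have "openin (vietoris X) (vietoris_basic X [U])" by (intro openin_vietoris_basic) auto
    moreover have "{x} \<in> vietoris_basic X [U]" using x U by (auto simp: vietoris_basic_def compacts_of_def)
    ultimately obtain A where "A \<in> P {x}" "A \<subseteq> vietoris_basic X [U]"
      using weak_base_small[OF wb] by blast
    moreover have "{z. {z} \<in> vietoris_basic X [U]} \<subseteq> U" by (auto simp: vietoris_basic_def)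
    ultimately show "\<exists>A\<in>(\<lambda>A. {z. {z} \<in> A}) ` P {x}. A \<subseteq> U"
      by (intro bexI[of _ "{z. {z} \<in> A}"]) auto
  next
    fix G assume G: "G \<subseteq> topspace X \<and> (\<forall>x\<in>G. \<exists>A\<in>(\<lambda>A. {z. {z} \<in> A}) ` P {x}. A \<subseteq> G)"
    \<comment> \<open>Adding the open set of all non-singletons to the copy of \<open>G\<close> leaves only singletons to be tested.\<close>
    let ?N = "{K \<in> compacts_of X. \<forall>x. K \<noteq> {x}}"
    have N: "openin (vietoris X) ?N"
    proof (subst openin_subopen, intro strip)
      fix K assume K: "K \<in> ?N"
      then obtain a where "a \<in> K" "K \<noteq> {a}" by (auto simp: compacts_of_def)
      then obtain b where ab: "a \<in> K" "b \<in> K" "a \<noteq> b" by blast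
      have KX: "K \<subseteq> topspace X" using K compactin_subset_topspace by (auto simp: compacts_of_def)
      then obtain U V where UV: "openin X U" "openin X V" "a \<in> U" "b \<in> V" "disjnt U V"
        using X ab(3) subsetD[OF KX ab(1)] subsetD[OF KX ab(2)] unfolding Hausdorff_space_def by meson
      \<comment> \<open>A set meeting both of the disjoint sets \<open>U\<close> and
        \<open>V\<close> has at least two points.\<close>
      let ?B = "vietoris_basic X [topspace X, U, V]"
      have "openin (vietoris X) ?B" using UV by (intro openin_vietoris_basic) auto
      moreover have "K \<in> ?B" using K KX ab UV by (auto simp: vietoris_basic_def compacts_of_def)
      moreover have "?B \<subseteq> ?N" using UV(5) by (auto simp: vietoris_basic_def disjnt_iff)
      ultimately show "\<exists>T. openin (vietoris X) T \<and> K \<in> T \<and> T \<subseteq> ?N" by blast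
    qed
    let ?H = "?N \<union> (\<lambda>x. {x}) ` G"
    have "openin (vietoris X) ?H"
    proof (rule weak_base_openin[OF wb])
      show "?H \<subseteq> topspace (vietoris X)" using G by (auto simp: topspace_vietoris compacts_of_def)
      fix K assume K: "K \<in> ?H"
      show "\<exists>A\<in>P K. A \<subseteq> ?H"
      proof (cases "K \<in> ?N")
        case True
        from weak_base_small[OF wb N this] show ?thesis by blast
      next
        case False
        then obtain x where x: "x \<in> G" "K = {x}" using K by blast
        then obtain A where A: "A \<in> P {x}" "{z. {z} \<in> A} \<subseteq> G" using G by blast
        have "{x} \<in> topspace (vietoris X)" using x G sing by blast
        then have "A \<subseteq> compacts_of X" using weak_base_subset[OF wb _ A(1)] by (simp add: topspace_vietoris)
        then have "A \<subseteq> ?H" using A(2) by auto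
        then show ?thesis using A(1) x by blast
      qed
    qed
    then have "openin X {x \<in> topspace X. {x} \<in> ?H}"
      by (rule openin_continuous_map_preimage[OF continuous_map_sing_vietoris])
    moreover have "{x \<in> topspace X. {x} \<in> ?H} = G" using G by auto
    ultimately show "openin X G" by simp
  qed
qed

text \<open>The open neighbourhood of \<open>x\<close> inside \<open>D\<close> is the complement of
  \<open>S\<close>. It omits every point outside \<open>D\<close> because of constant sequences, and
  it contains \<open>x\<close> because a sequence converging to \<open>x\<close> is eventually in
  \<open>D\<close>.\<close>

lemma weak_base_sing_vietoris_neighbourhood:
  assumes X: "Hausdorff_space X" and wb: "weak_base (vietoris X) P"
    and cnt: "\<And>K. K \<in> topspace (vietoris X) \<Longrightarrow> countable (P K)"
    and x: "x \<in> topspace X" and D: "D \<in> (\<lambda>A. {z. {z} \<in> A}) ` P {x}"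
  shows "x \<in> X interior_of D"
proof -
  let ?P = "\<lambda>x. (\<lambda>A. {z. {z} \<in> A}) ` P {x}"
  note wbX = weak_base_sing_vietoris[OF X wb]
  have cntX: "countable (?P z)" if "z \<in> topspace X" for z
    using cnt[of "{z}"] that by (simp add: topspace_vietoris compacts_of_def)
  \<comment> \<open>The diagonal argument makes the sequential closure of the complement of \<open>D\<close> closed.\<close>
  define S where "S = {z. \<exists>s. (\<forall>n. s n \<in> topspace X - D) \<and> limitin X s z sequentially}"
  have "\<exists>A\<in>?P z. A \<subseteq> topspace X - S" if z: "z \<in> topspace X - S" for z
  proof (rule ccontr)
    assume *: "\<not> ?thesis"
    have zX: "z \<in> topspace X" using z by blast
    obtain Q :: "nat \<Rightarrow> _" where Q: "\<And>n. Q n \<in> ?P z" and dec: "\<And>m n. m \<le> n \<Longrightarrow> Q n \<subseteq> Q m"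
      and small: "\<And>U. \<lbrakk>openin X U; z \<in> U\<rbrakk> \<Longrightarrow> \<exists>n. Q n \<subseteq> U"
      using weak_base_decreasing_sequence[OF wbX zX cntX[OF zX]] by blast
    have "Q n \<subseteq> topspace X" for n by (rule weak_base_subset[OF wbX zX Q])
    moreover have "\<not> Q n \<subseteq> topspace X - S" for n using * bexI[OF _ Q[of n]] by meson
    ultimately have "\<exists>u. u \<in> Q n \<and> u \<in> S" for n by blast
    then obtain xs where xs: "\<And>n. xs n \<in> Q n" "\<And>n. xs n \<in> S" by metis
    have lim: "limitin X xs z sequentially"
      unfolding limitin_sequentially
    proof (intro conjI allI impI zX)
      fix U assume "openin X U \<and> z \<in> U"
      then obtain N where "Q N \<subseteq> U" using small by blast
      then show "\<exists>N. \<forall>n. N \<le> n \<longrightarrow> xs n \<in> U" using xs dec by blast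
    qed
    have "\<exists>s. (\<forall>m. s m \<in> topspace X - D) \<and> limitin X s (xs n) sequentially" for n
      using xs(2)[of n] by (simp add: S_def)
    then obtain xx where xx: "\<And>n m. xx n m \<in> topspace X - D"
      and lims: "\<And>n. limitin X (xx n) (xs n) sequentially"
      by metis
    \<comment> \<open>Each \<open>xs n\<close> lies in \<open>S\<close> and \<open>z\<close> does
      not; the diagonal argument needs this to separate \<open>xs n\<close> from \<open>z\<close>,
      and its conclusion contradicts the choice of \<open>z\<close>.\<close>
    have "xs n \<noteq> z" for n using xs(2)[of n] z by blast
    from diagonal_convergence[OF X wb cnt lim this lims]
    obtain m where "limitin X (\<lambda>n. xx n (m n)) z sequentially" by blast
    then have "z \<in> S"
      using xx unfolding S_def by (intro CollectI exI[of _ "\<lambda>n. xx n (m n)"] conjI allI)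
    with z show False by blast
  qed
  then have "openin X (topspace X - S)" by (intro weak_base_openin[OF wbX]) auto
  moreover have "x \<notin> S"
  proof
    assume "x \<in> S"
    then obtain s where s: "\<And>n. s n \<in> topspace X - D" "limitin X s x sequentially" by (auto simp: S_def)
    have "\<forall>\<^sub>F n in sequentially. s n \<in> D" by (rule weak_base_eventually[OF X wbX s(2) D])
    then show False using s(1) by (simp add: eventually_sequentially) blast
  qed
  moreover have "topspace X - S \<subseteq> D"
  proof
    fix u assume u: "u \<in> topspace X - S"
    show "u \<in> D"
    proof (rule ccontr)
      assume "u \<notin> D"
      moreover have "limitin X (\<lambda>n. u) u sequentially" using u by (simp add: limitin_const_iff)
      ultimately have "u \<in> S"
        using u unfolding S_def by (intro CollectI exI[of _ "\<lambda>n. u"]) auto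
      with u show False by blast
    qed
  qed
  ultimately show ?thesis using x by (auto simp: interior_of_def)
qed

lemma sigma_locally_finite_weak_base_vietoris_imp_metrizable:
  assumes reg: "regular_space X" and X: "Hausdorff_space X" and wb: "weak_base (vietoris X) P"
    and slf: "sigma_locally_finite (vietoris X) (\<Union>K\<in>topspace (vietoris X). P K)"
  shows "metrizable_space X"
proof -
  obtain \<F> :: "nat \<Rightarrow> 'a set set set" where \<F>: "(\<Union>K\<in>topspace (vietoris X). P K) = (\<Union>n. \<F> n)"
    and lf: "\<And>n. locally_finite_family (vietoris X) (\<F> n)"
    using slf unfolding sigma_locally_finite_def by blast
  let ?r = "\<lambda>A. X interior_of {z. {z} \<in> A}"
  have nbhd: "x \<in> ?r A" if "x \<in> topspace X" "A \<in> P {x}" for x A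
    by (rule weak_base_sing_vietoris_neighbourhood[OF X wb countable_weak_base_at[OF slf wb]]) (use that in auto)
  show ?thesis
  proof (rule Nagata_Smirnov[OF reg Hausdorff_imp_t1_space[OF X], of "\<lambda>n. ?r ` \<F> n"])
    fix n
    show "locally_finite_family X (?r ` \<F> n)"
      unfolding locally_finite_family_def
    proof
      fix x assume x: "x \<in> topspace X"
      then have "{x} \<in> topspace (vietoris X)" by (simp add: topspace_vietoris compacts_of_def)
      then obtain V where V: "openin (vietoris X) V" "{x} \<in> V" "finite {A \<in> \<F> n. A \<inter> V \<noteq> {}}"
        using lf[of n] unfolding locally_finite_family_def by blast
      let ?V = "{z \<in> topspace X. {z} \<in> V}"
      \<comment> \<open>A point \<open>z\<close> common to \<open>?r A\<close> and \<open>?V\<close>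
        yields the element \<open>{z}\<close> of \<open>A \<inter> V\<close>, so local finiteness
        pulls back along the singleton map.\<close>
      have "{B \<in> ?r ` \<F> n. B \<inter> ?V \<noteq> {}} \<subseteq> ?r ` {A \<in> \<F> n. A \<inter> V \<noteq> {}}"
        using interior_of_subset by fastforce
      then have "finite {B \<in> ?r ` \<F> n. B \<inter> ?V \<noteq> {}}"
        by (rule finite_subset) (use V in simp)
      moreover have "openin X ?V"
        by (rule openin_continuous_map_preimage[OF continuous_map_sing_vietoris V(1)])
      ultimately show "\<exists>V. openin X V \<and> x \<in> V \<and> finite {B \<in> ?r ` \<F> n. B \<inter> V \<noteq> {}}"
        using V(2) x by (intro exI[of _ ?V]) simp
    qed
    show "openin X B" if "B \<in> ?r ` \<F> n" for B using that by auto
  next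
    fix U x assume U: "openin X U" "x \<in> U"
    then have x: "x \<in> topspace X" using openin_subset by blast
    then obtain D where D: "D \<in> (\<lambda>A. {z. {z} \<in> A}) ` P {x}" "D \<subseteq> U"
      using weak_base_small[OF weak_base_sing_vietoris[OF X wb] U] by blast
    then obtain A where A: "A \<in> P {x}" "D = {z. {z} \<in> A}" by blast
    have "{x} \<in> topspace (vietoris X)" using x by (simp add: topspace_vietoris compacts_of_def)
    then obtain n where "A \<in> \<F> n" using \<F> A(1) by blast
    moreover have "?r A \<subseteq> U" using D(2) interior_of_subset unfolding A(2) by (rule order_trans[rotated])
    ultimately show "\<exists>n. \<exists>B\<in>?r ` \<F> n. x \<in> B \<and> B \<subseteq> U" using nbhd[OF x A(1)] by blast
  qed
qed

theorem theorem3p13: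
  fixes X :: "'a topology"
  assumes "regular_space X" and "Hausdorff_space X"
  shows "(metrizable_space X \<longleftrightarrow>
            (\<exists>P. weak_base (vietoris X) P \<and>
                 sigma_locally_finite (vietoris X) (\<Union>y\<in>topspace (vietoris X). P y)))
       \<and> (metrizable_space X \<longleftrightarrow> metrizable_space (vietoris X))"
  using sigma_locally_finite_weak_base_vietoris_imp_metrizable[OF assms]
    metrizable_imp_sigma_locally_finite_weak_base[of "vietoris X"]
    metrizable_imp_metrizable_vietoris[of X] metrizable_vietoris_imp_metrizable[of X]
  by blast

end
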